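(* Let $n>0$ be an integer, $A=\{0,\dots,n\}$, and let $\tau:A\to A^+$ be the (primitive, one-to-one, constant-length $5$) substitution $\tau(a)=0\,a\,a\,(a+1)\,0$ for $a\in A$, where $n+1$ is read as $0$. For $a\in A$ let $$x(a)=\dots\tau^i(0)\dots\tau(0)\,0\,.\,a\,a\,(a+1)\,0\,\tau(a(a+1)0)\dots\tau^i(a(a+1)0)\dots\in X_\tau,$$ where the zero coordinate is the one just after the central dot. Then $S=\{x(a):a\in A\}$ is a scrambled set of $(X_\tau,T)$ of size $|A|$.
   Context: Substitutions are extended to finite words by concatenation. $T$ is the shift $T((x_i)_i)=(x_{i+1})_i$ on $A^{\mathbb Z}$. $X_\tau$ is the smallest subshift (closed shift-invariant subset) of $A^{\mathbb Z}$ in which all words $\tau^m(a)$, $m\ge0$, $a\in A$, appear; fix a metric $\varrho$ compatible with its topology. A pair $\{x,y\}$ is a Li–Yorke pair if $\limsup_{m\to\infty}\varrho(T^mx,T^my)>0$ and $\liminf_{m\to\infty}\varrho(T^mx,T^my)=0$. A set $S$ is scrambled if any pair of distinct points of $S$ is a Li–Yorke pair. *)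

theory Defs
  imports "HOL-Analysis.Analysis" "HOL-Library.Stream"
begin

subsection \<open>Subshifts and Li--Yorke pairs\<close>

definition full_shift_topology :: "'a set \<Rightarrow> (int \<Rightarrow> 'a) topology" where
  "full_shift_topology A = product_topology (\<lambda>_. discrete_topology A) UNIV"

definition shift_map :: "(int \<Rightarrow> 'a) \<Rightarrow> (int \<Rightarrow> 'a)" where
  "shift_map x = (\<lambda>i. x (i + 1))"

definition subshift :: "'a set \<Rightarrow> (int \<Rightarrow> 'a) set \<Rightarrow> bool" where
  "subshift A X \<longleftrightarrow> closedin (full_shift_topology A) X \<and> shift_map ` X = X"

definition word_appears :: "'a list \<Rightarrow> (int \<Rightarrow> 'a) \<Rightarrow> bool" where
  "word_appears w x \<longleftrightarrow> (\<exists>k. \<forall>j < length w. x (k + int j) = w ! j)"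

text \<open>Limits superior and inferior are taken in the extended reals, because \<open>real\<close> is not a
  complete lattice.\<close>

definition li_yorke_pair ::
    "('x \<Rightarrow> 'x) \<Rightarrow> ('x \<Rightarrow> 'x \<Rightarrow> real) \<Rightarrow> 'x \<Rightarrow> 'x \<Rightarrow> bool" where
  "li_yorke_pair T \<rho> x y \<longleftrightarrow>
     limsup (\<lambda>m. ereal (\<rho> ((T ^^ m) x) ((T ^^ m) y))) > 0 \<and>
     liminf (\<lambda>m. ereal (\<rho> ((T ^^ m) x) ((T ^^ m) y))) = 0"

definition scrambled :: "('x \<Rightarrow> 'x) \<Rightarrow> ('x \<Rightarrow> 'x \<Rightarrow> real) \<Rightarrow> 'x set \<Rightarrow> bool" where
  "scrambled T \<rho> S \<longleftrightarrow> (\<forall>x\<in>S. \<forall>y\<in>S. x \<noteq> y \<longrightarrow> li_yorke_pair T \<rho> x y)"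


subsection \<open>Substitutions\<close>

definition subst_word :: "('a \<Rightarrow> 'a list) \<Rightarrow> 'a list \<Rightarrow> 'a list" where
  "subst_word \<sigma> w = concat (map \<sigma> w)"

text \<open>\<open>LEAST\<close> refers to inclusion of sets.\<close>

definition substitution_subshift :: "'a set \<Rightarrow> ('a \<Rightarrow> 'a list) \<Rightarrow> (int \<Rightarrow> 'a) set" where
  "substitution_subshift A \<sigma> =
     (LEAST X. subshift A X \<and>
        (\<forall>m. \<forall>a\<in>A. \<exists>x\<in>X. word_appears ((subst_word \<sigma> ^^ m) [a]) x))"


subsection \<open>The substitution \<open>\<tau>\<close> and the points \<open>x(a)\<close>\<close>

definition succ_letter :: "nat \<Rightarrow> nat \<Rightarrow> nat" where
  "succ_letter n a = (if a = n then 0 else a + 1)"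

definition tau :: "nat \<Rightarrow> nat \<Rightarrow> nat list" where
  "tau n a = [0, a, a, succ_letter n a, 0]"

definition X_tau :: "nat \<Rightarrow> (int \<Rightarrow> nat) set" where
  "X_tau n = substitution_subshift {0..n} (tau n)"

text \<open>The half of \<open>x(a)\<close> to the left of the dot, \<open>\<dots>\<tau>\<^sup>i(0)\<dots>\<tau>(0) 0\<close>, is read from right to
  left, so each block is reversed and the first letter of the stream is the one at
  coordinate \<open>-1\<close>.\<close>

definition left_half :: "nat \<Rightarrow> nat stream" where
  "left_half n = flat (smap (\<lambda>i. rev ((subst_word (tau n) ^^ i) [0])) nats)"

definition right_half :: "nat \<Rightarrow> nat \<Rightarrow> nat stream" where
  "right_half n a =
     flat ([a, a, succ_letter n a, 0] ##
           smap (\<lambda>i. (subst_word (tau n) ^^ i) [a, succ_letter n a, 0]) (fromN 1))"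

definition x_point :: "nat \<Rightarrow> nat \<Rightarrow> (int \<Rightarrow> nat)" where
  "x_point n a = (\<lambda>k. if k \<ge> 0 then right_half n a !! nat k else left_half n !! nat (- 1 - k))"

end

theory Submission imports Defs begin

text \<open>The proof rests on two recurrences. Let \<open>c\<^sub>i = 1 + 5 + \<dots> + 5\<^sup>i\<^sup>-\<^sup>1\<close>, the length of
  \<open>\<tau>\<^sup>i\<^sup>-\<^sup>1(0)\<dots>\<tau>(0) 0\<close>. Unfolding \<open>\<tau>\<^sup>i(a)\<close> along its second letter shows that the window
  \<open>[-c\<^sub>i, 5\<^sup>i - c\<^sub>i)\<close> of \<open>x(a)\<close> reads exactly \<open>\<tau>\<^sup>i(a)\<close> (lemma \<open>x_point_window\<close>). Since
  \<open>\<tau>\<^sup>i\<^sup>+\<^sup>1(a) = \<tau>\<^sup>i(0) \<tau>\<^sup>i(a) \<tau>\<^sup>i(a) \<tau>\<^sup>i(a+1) \<tau>\<^sup>i(0)\<close> and the window of level \<open>i\<close> is the second of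
  these five blocks, the third block is a copy of that window translated by \<open>5\<^sup>i\<close>, while the
  last block, translated by \<open>3\<cdot>5\<^sup>i\<close>, reads \<open>\<tau>\<^sup>i(0)\<close>, the window of level \<open>i\<close> of \<open>x(0)\<close>. The windows
  exhaust the integers, so for every letter \<open>a\<close>

  \<open>T\<^bsup>5^i\<^esup> x(a) \<longlonglongrightarrow> x(a)\<close> and \<open>T\<^bsup>3\<cdot>5^i\<^esup> x(a) \<longlonglongrightarrow> x(0)\<close>.

  The same times serve all letters. Along the first sequence the distance of the shifts of
  \<open>x(a)\<close> and \<open>x(b)\<close> tends to \<open>\<rho>(x(a), x(b)) > 0\<close>; along the second both points approach \<open>x(0)\<close>
  and the distance tends to \<open>0\<close>. This is \<open>li_yorke_pair_if_subsequences\<close>, and it involves the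
  metric only through the topology.

  It remains to know that the points belong to \<open>X\<^sub>\<tau>\<close>. For any substitution \<open>\<sigma>\<close>, a point all of
  whose finite windows occur in some \<open>\<sigma>\<^sup>m(a)\<close> lies in every subshift in which all these words
  appear, because it is a limit of shifts of points of that subshift. Hence the set of such
  points is the smallest subshift in question, as soon as the words appear in it
  (lemma \<open>substitution_subshift_eq_language_shift\<close>); for \<open>\<tau>\<close> they already appear in \<open>x(0)\<close>,
  as every letter occurs in some \<open>\<tau>\<^sup>b(0)\<close>.\<close>


section \<open>Subshifts\<close>

lemma topspace_full_shift [simp]: "topspace (full_shift_topology A) = {x. range x \<subseteq> A}"
  by (auto simp: full_shift_topology_def PiE_def)

lemma limitin_full_shiftI:
  assumes "range x \<subseteq> A" and "\<forall>\<^sub>F m in F. range (f m) \<subseteq> A"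
    and "\<And>k. \<forall>\<^sub>F m in F. f m k = x k"
  shows "limitin (full_shift_topology A) f x F"
proof -
  have "limitin (discrete_topology A) (\<lambda>m. f m k) (x k) F" for k
    unfolding limitin_def using assms(1) eventually_mono[OF assms(3)[of k]] by fastforce
  moreover have "\<forall>\<^sub>F m in F. f m \<in> topspace (full_shift_topology A)"
    using assms(2) by simp
  ultimately show ?thesis
    by (auto simp: full_shift_topology_def limitin_componentwise)
qed

lemma openin_cylinder:
  assumes "finite W"
  shows "openin (full_shift_topology A) {y. range y \<subseteq> A \<and> (\<forall>i\<in>W. y i = x i)}"
proof -
  let ?U = "\<lambda>i. if i \<in> W then {x i} \<inter> A else A"
  have "openin (full_shift_topology A) (\<Pi>\<^sub>E i\<in>UNIV. ?U i)"
    unfolding full_shift_topology_def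
    by (rule product_topology_basis) (auto intro: finite_subset[OF _ assms])
  also have "(\<Pi>\<^sub>E i\<in>UNIV. ?U i) = {y. range y \<subseteq> A \<and> (\<forall>i\<in>W. y i = x i)}"
    by (auto simp: PiE_def Pi_def split: if_splits)
  finally show ?thesis .
qed

lemma funpow_shift_map: "(shift_map ^^ m) x = (\<lambda>i. x (i + int m))"
  by (induction m) (auto simp: shift_map_def algebra_simps)

lemma subshift_translate:
  assumes "subshift A X" "x \<in> X"
  shows "(\<lambda>i. x (i + d)) \<in> X"
proof (induction d rule: int_induct[where k = 0])
  case base
  then show ?case using assms by simp
next
  case (step1 d)
  then have "shift_map (\<lambda>i. x (i + d)) \<in> X"
    using assms(1) unfolding subshift_def by blast
  then show ?case by (simp add: shift_map_def algebra_simps)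
next
  case (step2 d)
  then obtain z where z: "z \<in> X" "shift_map z = (\<lambda>i. x (i + d))"
    using assms(1) unfolding subshift_def by (metis imageE)
  have "z i = x (i + (d - 1))" for i
    using fun_cong[OF z(2), of "i - 1"] by (simp add: shift_map_def algebra_simps)
  then have "z = (\<lambda>i. x (i + (d - 1)))" by blast
  then show ?case using z(1) by simp
qed


section \<open>The subshift of a substitution\<close>

abbreviation superword :: "('a \<Rightarrow> 'a list) \<Rightarrow> nat \<Rightarrow> 'a \<Rightarrow> 'a list" where
  "superword \<sigma> m a \<equiv> (subst_word \<sigma> ^^ m) [a]"

definition language_shift :: "'a set \<Rightarrow> ('a \<Rightarrow> 'a list) \<Rightarrow> (int \<Rightarrow> 'a) set" where
  "language_shift A \<sigma> = {x. \<forall>k l. \<exists>m. \<exists>a\<in>A. \<exists>p. p + l \<le> length (superword \<sigma> m a) \<and>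
     (\<forall>j<l. x (k + int j) = superword \<sigma> m a ! (p + j))}"

lemma subst_word_funpow_append:
  "(subst_word \<sigma> ^^ m) (u @ v) = (subst_word \<sigma> ^^ m) u @ (subst_word \<sigma> ^^ m) v"
  by (induction m) (auto simp: subst_word_def)

lemma superword_Suc: "superword \<sigma> (Suc m) a = (subst_word \<sigma> ^^ m) (\<sigma> a)"
  by (simp add: funpow_swap1 subst_word_def)

lemma set_subst_word: "set (subst_word \<sigma> w) = (\<Union>a\<in>set w. set (\<sigma> a))"
  by (simp add: subst_word_def)

lemma set_superword:
  assumes "\<And>a. a \<in> A \<Longrightarrow> set (\<sigma> a) \<subseteq> A" "a \<in> A"
  shows "set (superword \<sigma> m a) \<subseteq> A"
proof (induction m)
  case (Suc m)
  then show ?case using assms(1) by (fastforce simp: set_subst_word)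
qed (use assms in auto)

lemma language_shift_translate:
  assumes "x \<in> language_shift A \<sigma>"
  shows "(\<lambda>i. x (i + d)) \<in> language_shift A \<sigma>"
  unfolding language_shift_def
proof (intro CollectI allI)
  fix k :: int and l :: nat
  show "\<exists>m. \<exists>a\<in>A. \<exists>p. p + l \<le> length (superword \<sigma> m a) \<and>
     (\<forall>j<l. x (k + int j + d) = superword \<sigma> m a ! (p + j))"
    using assms[unfolded language_shift_def, simplified, rule_format, of l "k + d"]
    by (simp add: algebra_simps)
qed

lemma range_language_shift:
  assumes "\<And>a. a \<in> A \<Longrightarrow> set (\<sigma> a) \<subseteq> A" "x \<in> language_shift A \<sigma>"
  shows "range x \<subseteq> A"
proof clarify
  fix k
  obtain m a p where "a \<in> A" "p + 1 \<le> length (superword \<sigma> m a)"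
    "\<forall>j<1. x (k + int j) = superword \<sigma> m a ! (p + j)"
    using assms(2) unfolding language_shift_def by blast
  then have "x k \<in> set (superword \<sigma> m a)" by simp
  then show "x k \<in> A" using set_superword[of A \<sigma> a m] assms(1) \<open>a \<in> A\<close> by blast
qed

lemma subshift_language_shift:
  assumes "\<And>a. a \<in> A \<Longrightarrow> set (\<sigma> a) \<subseteq> A"
  shows "subshift A (language_shift A \<sigma>)"
  unfolding subshift_def
proof
  let ?L = "language_shift A \<sigma>"
  have "full_shift_topology A closure_of ?L \<subseteq> ?L"
  proof
    fix x assume x: "x \<in> full_shift_topology A closure_of ?L"
    then have rx: "range x \<subseteq> A" by (simp add: in_closure_of)
    show "x \<in> ?L"
      unfolding language_shift_def
    proof (intro CollectI allI)
      fix k :: int and l :: nat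
      let ?C = "{y. range y \<subseteq> A \<and> (\<forall>i\<in>{k..<k + int l}. y i = x i)}"
      have "openin (full_shift_topology A) ?C" by (rule openin_cylinder) simp
      moreover have "x \<in> ?C" using rx by simp
      moreover have "\<And>T. x \<in> T \<and> openin (full_shift_topology A) T \<Longrightarrow> \<exists>y. y \<in> ?L \<and> y \<in> T"
        using x by (simp only: in_closure_of)
      ultimately have "\<exists>y. y \<in> ?L \<and> y \<in> ?C" by (meson conjI)
      then obtain y where y: "y \<in> ?L" and yx: "\<forall>i\<in>{k..<k + int l}. y i = x i"
        by blast
      have "x (k + int j) = y (k + int j)" if "j < l" for j
        by (rule bspec[OF yx, symmetric]) (simp add: that)
      moreover obtain m a p where "a \<in> A" "p + l \<le> length (superword \<sigma> m a)"
        "\<forall>j<l. y (k + int j) = superword \<sigma> m a ! (p + j)"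
        using y unfolding language_shift_def by blast
      ultimately show "\<exists>m. \<exists>a\<in>A. \<exists>p. p + l \<le> length (superword \<sigma> m a) \<and>
          (\<forall>j<l. x (k + int j) = superword \<sigma> m a ! (p + j))"
        by auto
    qed
  qed
  moreover have "?L \<subseteq> topspace (full_shift_topology A)"
    using range_language_shift[of A \<sigma>] assms by auto
  ultimately show "closedin (full_shift_topology A) ?L"
    by (simp add: closure_of_subset_eq[symmetric])
  show "shift_map ` ?L = ?L"
  proof
    show "shift_map ` ?L \<subseteq> ?L"
      using language_shift_translate[of _ A \<sigma> 1] by (auto simp: shift_map_def)
    show "?L \<subseteq> shift_map ` ?L"
    proof
      fix x assume "x \<in> ?L"
      then have "(\<lambda>i. x (i + (- 1))) \<in> ?L" by (rule language_shift_translate)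
      moreover have "x = shift_map (\<lambda>i. x (i + (- 1)))" by (simp add: shift_map_def)
      ultimately show "x \<in> shift_map ` ?L" by blast
    qed
  qed
qed

text \<open>Each window of a point of the language shift occurs in some iterated word, hence in
  a point of \<open>Y\<close>, and translating that point moves the occurrence to the position of the window.
  So the point is a limit of points of the closed set \<open>Y\<close>.\<close>

lemma language_shift_least:
  assumes "\<And>a. a \<in> A \<Longrightarrow> set (\<sigma> a) \<subseteq> A"
    and Y: "subshift A Y" "\<And>m a. a \<in> A \<Longrightarrow> \<exists>y\<in>Y. word_appears (superword \<sigma> m a) y"
  shows "language_shift A \<sigma> \<subseteq> Y"
proof
  fix x assume x: "x \<in> language_shift A \<sigma>"
  have "\<exists>y\<in>Y. \<forall>i. \<bar>i\<bar> \<le> int N \<longrightarrow> y i = x i" for N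
  proof -
    obtain m a p where a: "a \<in> A" and p: "p + (2 * N + 1) \<le> length (superword \<sigma> m a)"
      and w: "\<forall>j<2 * N + 1. x (- int N + int j) = superword \<sigma> m a ! (p + j)"
      using x unfolding language_shift_def by blast
    obtain y q where y: "y \<in> Y"
      and q: "\<forall>j < length (superword \<sigma> m a). y (q + int j) = superword \<sigma> m a ! j"
      using Y(2)[OF a] unfolding word_appears_def by blast
    let ?z = "\<lambda>i. y (i + (q + int p + int N))"
    have "?z i = x i" if "\<bar>i\<bar> \<le> int N" for i
    proof -
      define j where "j = nat (i + int N)"
      have j: "j < 2 * N + 1" "i = - int N + int j" using that by (auto simp: j_def)
      have "i + (q + int p + int N) = q + int (p + j)" using j(2) by simp
      then have "?z i = y (q + int (p + j))" by (rule arg_cong)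
      also have "\<dots> = superword \<sigma> m a ! (p + j)"
        using q j(1) p by (meson add_strict_left_mono less_le_trans)
      also have "\<dots> = x i" using w j by metis
      finally show ?thesis .
    qed
    then show ?thesis by (intro bexI[of _ ?z] subshift_translate[OF Y(1) y]) simp
  qed
  then obtain y where y: "\<And>N. y N \<in> Y" "\<And>N i. \<bar>i\<bar> \<le> int N \<Longrightarrow> y N i = x i"
    by metis
  have "Y \<subseteq> {x. range x \<subseteq> A}"
    using Y(1) closedin_subset unfolding subshift_def by fastforce
  then have "\<forall>\<^sub>F N in sequentially. range (y N) \<subseteq> A"
    using y(1) by (intro always_eventually) blast
  moreover have "\<forall>\<^sub>F N in sequentially. y N k = x k" for k
    using eventually_ge_at_top[of "nat \<bar>k\<bar>"] by eventually_elim (auto intro: y(2))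
  ultimately have "limitin (full_shift_topology A) y x sequentially"
    using range_language_shift[of A \<sigma>] assms(1) x by (intro limitin_full_shiftI) auto
  then show "x \<in> Y"
    by (rule limitin_closedin) (use Y(1) y(1) in \<open>simp_all add: subshift_def\<close>)
qed

lemma substitution_subshift_eq_language_shift:
  assumes "\<And>a. a \<in> A \<Longrightarrow> set (\<sigma> a) \<subseteq> A"
    and "\<And>m a. a \<in> A \<Longrightarrow> \<exists>x\<in>language_shift A \<sigma>. word_appears (superword \<sigma> m a) x"
  shows "substitution_subshift A \<sigma> = language_shift A \<sigma>"
  unfolding substitution_subshift_def
proof (rule Least_equality)
  show "subshift A (language_shift A \<sigma>) \<and>
      (\<forall>m. \<forall>a\<in>A. \<exists>x\<in>language_shift A \<sigma>. word_appears (superword \<sigma> m a) x)"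
    by (intro conjI subshift_language_shift allI ballI assms)
  show "language_shift A \<sigma> \<subseteq> Y" if "subshift A Y \<and>
      (\<forall>m. \<forall>a\<in>A. \<exists>x\<in>Y. word_appears (superword \<sigma> m a) x)" for Y
  proof (rule language_shift_least)
    show "set (\<sigma> a) \<subseteq> A" if "a \<in> A" for a using assms(1)[OF that] .
    show "subshift A Y" using that by (rule conjunct1)
    show "\<exists>y\<in>Y. word_appears (superword \<sigma> m a) y" if "a \<in> A" for m a
      using conjunct2[OF \<open>subshift A Y \<and> _\<close>] that by (meson bspec)
  qed
qed


section \<open>Li--Yorke pairs from convergent subsequences\<close>

lemma (in Metric_space) mdist_tendsto:
  assumes "limitin mtopology u x F" "limitin mtopology v y F"
  shows "((\<lambda>i. d (u i) (v i)) \<longlongrightarrow> d x y) F"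
proof -
  have u: "((\<lambda>i. d (u i) x) \<longlongrightarrow> 0) F" "\<forall>\<^sub>F i in F. u i \<in> M" "x \<in> M"
    and v: "((\<lambda>i. d (v i) y) \<longlongrightarrow> 0) F" "\<forall>\<^sub>F i in F. v i \<in> M" "y \<in> M"
    using assms unfolding limitin_metric_dist_null by blast+
  have "\<forall>\<^sub>F i in F. norm (d (u i) (v i) - d x y) \<le> d (u i) x + d (v i) y"
    using u(2) v(2)
  proof eventually_elim
    case (elim i)
    have "d (u i) (v i) \<le> d (u i) x + d x y + d (v i) y"
      using triangle[of "u i" x "v i"] triangle'[of x y "v i"] elim u(3) v(3) by auto
    moreover have "d x y \<le> d (u i) x + d (u i) (v i) + d (v i) y"
      using triangle''[of x "u i" y] triangle[of "u i" "v i" y] elim u(3) v(3) by auto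
    ultimately show ?case by (auto simp: abs_le_iff)
  qed
  moreover have "((\<lambda>i. d (u i) x + d (v i) y) \<longlongrightarrow> 0) F"
    using tendsto_add[OF u(1) v(1)] by simp
  ultimately have "((\<lambda>i. d (u i) (v i) - d x y) \<longlongrightarrow> 0) F"
    by (rule Lim_null_comparison)
  then show ?thesis by (simp add: LIM_zero_iff)
qed

lemma (in Metric_space) li_yorke_pair_if_subsequences:
  assumes "x \<noteq> y" "strict_mono r" "strict_mono s"
    and rx: "limitin mtopology (\<lambda>i. (T ^^ r i) x) x sequentially"
    and ry: "limitin mtopology (\<lambda>i. (T ^^ r i) y) y sequentially"
    and sx: "limitin mtopology (\<lambda>i. (T ^^ s i) x) z sequentially"
    and sy: "limitin mtopology (\<lambda>i. (T ^^ s i) y) z sequentially"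
  shows "li_yorke_pair T d x y"
proof -
  let ?D = "\<lambda>m. ereal (d ((T ^^ m) x) ((T ^^ m) y))"
  have M: "x \<in> M" "y \<in> M" "z \<in> M" using rx ry sx unfolding limitin_metric_dist_null by blast+
  have "(?D \<circ> r) \<longlonglongrightarrow> ereal (d x y)"
    using mdist_tendsto[OF rx ry] by (simp add: o_def)
  then have "limsup (?D \<circ> r) = ereal (d x y)"
    by (intro lim_imp_Limsup) auto
  then have "limsup ?D \<ge> ereal (d x y)"
    using limsup_subseq_mono[OF assms(2), of ?D] by simp
  moreover have "ereal (d x y) > 0" using M assms(1) by simp
  ultimately have "limsup ?D > 0" by (rule less_le_trans[rotated])
  have "(?D \<circ> s) \<longlonglongrightarrow> ereal (d z z)"
    using mdist_tendsto[OF sx sy] by (simp add: o_def)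
  then have "liminf (?D \<circ> s) = 0"
    using M by (simp add: lim_imp_Liminf zero_ereal_def)
  then have "liminf ?D \<le> 0"
    using liminf_subseq_mono[OF assms(3), of ?D] by simp
  moreover have "liminf ?D \<ge> 0" by (rule Liminf_bounded) simp
  ultimately show ?thesis
    using \<open>limsup ?D > 0\<close> by (simp add: li_yorke_pair_def)
qed


section \<open>The points \<open>x(a)\<close> and their windows\<close>

fun left_word :: "nat \<Rightarrow> nat \<Rightarrow> nat list" where
  "left_word n 0 = []"
| "left_word n (Suc i) = superword (tau n) i 0 @ left_word n i"

fun right_word :: "nat \<Rightarrow> nat \<Rightarrow> nat \<Rightarrow> nat list" where
  "right_word n a 0 = [a]"
| "right_word n a (Suc i) = right_word n a i @ (subst_word (tau n) ^^ i) [a, succ_letter n a, 0]"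

lemma superword_tau_Suc:
  "superword (tau n) (Suc i) a =
     superword (tau n) i 0 @ superword (tau n) i a @ superword (tau n) i a @
     superword (tau n) i (succ_letter n a) @ superword (tau n) i 0"
proof -
  have "tau n a = [0] @ [a] @ [a] @ [succ_letter n a] @ [0]" by (simp add: tau_def)
  then show ?thesis by (simp only: superword_Suc subst_word_funpow_append)
qed

lemma subst_word_three:
  "(subst_word \<sigma> ^^ i) [a, b, c] = superword \<sigma> i a @ superword \<sigma> i b @ superword \<sigma> i c"
proof -
  have "[a, b, c] = [a] @ [b] @ [c]" by simp
  then show ?thesis by (simp only: subst_word_funpow_append)
qed

text \<open>This is where the dot of \<open>x(a)\<close> falls in \<open>\<tau>\<^sup>i(a)\<close>: in front of the descendant of \<open>a\<close> reached
  by taking, in each image \<open>\<tau>(a) = 0 a a (a+1) 0\<close>, the first \<open>a\<close>.\<close>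

lemma superword_tau_split: "superword (tau n) i a = left_word n i @ right_word n a i"
proof (induction i)
  case (Suc i)
  have "superword (tau n) (Suc i) a = superword (tau n) i 0 @ superword (tau n) i a @
      (subst_word (tau n) ^^ i) [a, succ_letter n a, 0]"
    by (simp only: superword_tau_Suc subst_word_three append_assoc)
  then show ?case by (simp add: Suc)
qed simp

lemma length_superword_tau: "length (superword (tau n) i a) = 5 ^ i"
proof (induction i arbitrary: a)
  case (Suc i)
  show ?case unfolding superword_tau_Suc by (simp add: Suc)
qed simp

lemma superword_tau_nonempty: "superword (tau n) i a \<noteq> []"
proof -
  have "length (superword (tau n) i a) > 0" unfolding length_superword_tau by simp
  then show ?thesis by (rule length_greater_0_conv[THEN iffD1])
qed

lemma length_left_word: "4 * length (left_word n i) + 1 = 5 ^ i"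
proof (induction i)
  case (Suc i)
  have "length (left_word n (Suc i)) = 5 ^ i + length (left_word n i)"
    by (simp only: left_word.simps length_append length_superword_tau)
  then show ?case using Suc by simp
qed simp

lemma flat_smap_fromN:
  assumes "f i \<noteq> []"
  shows "flat (smap f (fromN i)) = f i @- flat (smap f (fromN (Suc i)))"
  by (subst flat_unfold) (use assms in simp_all)

lemma left_half_unfold:
  "left_half n = rev (left_word n i) @- flat (smap (\<lambda>i. rev (superword (tau n) i 0)) (fromN i))"
proof (induction i)
  case 0
  then show ?case by (simp add: left_half_def)
next
  case (Suc i)
  have ne: "rev (superword (tau n) i 0) \<noteq> []"
    using superword_tau_nonempty by simp
  show ?case
    unfolding Suc left_word.simps rev_append shift_append
    by (rule arg_cong[OF flat_smap_fromN]) (fact ne)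
qed

lemma right_half_unfold:
  "right_half n a = right_word n a (Suc i) @-
     flat (smap (\<lambda>i. (subst_word (tau n) ^^ i) [a, succ_letter n a, 0]) (fromN (Suc i)))"
proof (induction i)
  case 0
  show ?case
    unfolding right_half_def One_nat_def
    by (simp only: flat_Stream right_word.simps funpow_0 append.simps list.distinct not_False_eq_True)
next
  case (Suc i)
  have ne: "(subst_word (tau n) ^^ Suc i) [a, succ_letter n a, 0] \<noteq> []"
    unfolding subst_word_three using superword_tau_nonempty by blast
  show ?case
    unfolding Suc right_word.simps(2)[of n a "Suc i"] shift_append
    by (rule arg_cong[OF flat_smap_fromN]) (fact ne)
qed

lemma x_point_window:
  assumes "j < 5 ^ i"
  shows "x_point n a (int j - int (length (left_word n i))) = superword (tau n) i a ! j"
proof (cases "j < length (left_word n i)")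
  case True
  let ?c = "length (left_word n i)"
  have "nat (- 1 - (int j - int ?c)) = ?c - Suc j" using True by linarith
  then have "x_point n a (int j - int ?c) = left_half n !! (?c - Suc j)"
    using True by (simp add: x_point_def)
  also have "\<dots> = rev (left_word n i) ! (?c - Suc j)"
    using True by (simp add: left_half_unfold[of n i] del: rev_nth)
  also have "\<dots> = left_word n i ! j"
    using True by (simp add: rev_nth)
  finally show ?thesis using True by (simp add: superword_tau_split nth_append)
next
  case False
  let ?c = "length (left_word n i)"
  have len: "length (superword (tau n) i a) = ?c + length (right_word n a i)"
    by (simp add: superword_tau_split)
  have lt: "j - ?c < length (right_word n a i)"
    using False assms len by (simp add: length_superword_tau)
  have "x_point n a (int j - int ?c) = right_half n a !! (j - ?c)"
    using False by (simp add: x_point_def nat_diff_distrib)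
  also have "\<dots> = right_word n a (Suc i) ! (j - ?c)"
    unfolding right_half_unfold[of n a i] by (rule shift_snth_less) (use lt in simp)
  also have "\<dots> = right_word n a i ! (j - ?c)"
    by (simp only: right_word.simps nth_append lt if_True)
  finally show ?thesis using False by (simp add: superword_tau_split nth_append)
qed

lemma x_point_zero: "x_point n a 0 = a"
  using x_point_window[of 0 0 n a] by simp

lemma window_bound: "i \<le> length (left_word n i)"
proof (induction i)
  case (Suc i)
  have "length (superword (tau n) i 0) \<ge> 1" unfolding length_superword_tau by simp
  then show ?case using Suc unfolding left_word.simps length_append by linarith
qed simp

text \<open>The window of level \<open>i\<close> is \<open>[-c\<^sub>i, 3 c\<^sub>i + 1)\<close> by \<open>length_left_word\<close>, and \<open>c\<^sub>i \<ge> i\<close>. Hence the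
  windows exhaust the integers, which is what turns the recurrences below into limits.\<close>

lemma x_point_window_obtain:
  assumes "\<bar>k\<bar> \<le> int i"
  obtains j where "j < 5 ^ i" "k = int j - int (length (left_word n i))"
proof
  let ?j = "nat (k + int (length (left_word n i)))"
  have "k + int (length (left_word n i)) \<ge> 0"
    using assms window_bound[of i n] by linarith
  then show "k = int ?j - int (length (left_word n i))" by simp
  have "?j < 4 * length (left_word n i) + 1"
    using assms window_bound[of i n] by linarith
  then show "?j < 5 ^ i" by (simp only: length_left_word)
qed


section \<open>Recurrence of the points \<open>x(a)\<close>\<close>

text \<open>The window of level \<open>i + 1\<close> starts \<open>5\<^sup>i\<close> places to the left of the window of level \<open>i\<close>, so
  moving right by \<open>5\<^sup>i\<close> leads from the second block of \<open>\<tau>\<^sup>i\<^sup>+\<^sup>1(a)\<close> to the equal third one.\<close>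

lemma x_point_recurs:
  assumes "\<bar>k\<bar> \<le> int i"
  shows "x_point n a (k + 5 ^ i) = x_point n a k"
proof -
  obtain j where j: "j < 5 ^ i" "k = int j - int (length (left_word n i))"
    using x_point_window_obtain[OF assms] .
  have eq: "k + 5 ^ i = int (j + 2 * 5 ^ i) - int (length (left_word n (Suc i)))"
    unfolding j(2) left_word.simps length_append length_superword_tau by simp
  have "x_point n a (k + 5 ^ i) = superword (tau n) (Suc i) a ! (j + 2 * 5 ^ i)"
    unfolding eq by (rule x_point_window) (use j(1) in simp)
  also have "\<dots> = superword (tau n) i a ! j"
    unfolding superword_tau_Suc nth_append length_append length_superword_tau using j(1) by simp
  also have "\<dots> = x_point n a k"
    unfolding j(2) using x_point_window[OF j(1)] by (rule sym)
  finally show ?thesis .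
qed

text \<open>Moving right by \<open>3\<cdot>5\<^sup>i\<close> leads to the last block \<open>\<tau>\<^sup>i(0)\<close>, which is common to all \<open>x(a)\<close>.\<close>

lemma x_point_visits_x_point_0:
  assumes "\<bar>k\<bar> \<le> int i"
  shows "x_point n a (k + 3 * 5 ^ i) = x_point n 0 k"
proof -
  obtain j where j: "j < 5 ^ i" "k = int j - int (length (left_word n i))"
    using x_point_window_obtain[OF assms] .
  have eq: "k + 3 * 5 ^ i = int (j + 4 * 5 ^ i) - int (length (left_word n (Suc i)))"
    unfolding j(2) left_word.simps length_append length_superword_tau by simp
  have "x_point n a (k + 3 * 5 ^ i) = superword (tau n) (Suc i) a ! (j + 4 * 5 ^ i)"
    unfolding eq by (rule x_point_window) (use j(1) in simp)
  also have "\<dots> = superword (tau n) i 0 ! j"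
    unfolding superword_tau_Suc nth_append length_append length_superword_tau using j(1) by simp
  also have "\<dots> = x_point n 0 k"
    unfolding j(2) using x_point_window[OF j(1)] by (rule sym)
  finally show ?thesis .
qed


section \<open>The points \<open>x(a)\<close> belong to the subshift\<close>

lemma set_tau: "a \<in> {0..n} \<Longrightarrow> set (tau n a) \<subseteq> {0..n}"
  by (auto simp: tau_def succ_letter_def)

lemma x_point_in_language_shift:
  assumes "a \<in> {0..n}"
  shows "x_point n a \<in> language_shift {0..n} (tau n)"
  unfolding language_shift_def
proof (intro CollectI allI)
  fix k :: int and l :: nat
  define i where "i = nat \<bar>k\<bar> + l"
  let ?c = "length (left_word n i)"
  obtain p where p: "k = int p - int ?c"
    by (rule x_point_window_obtain[of k i n]) (simp add: i_def)
  obtain q where q: "q < 5 ^ i" "k + int l = int q - int ?c"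
    by (rule x_point_window_obtain[of "k + int l" i n]) (simp add: i_def)
  have "x_point n a (k + int j) = superword (tau n) i a ! (p + j)" if "j < l" for j
  proof -
    have eq: "k + int j = int (p + j) - int ?c" using p by simp
    have "p + j < 5 ^ i" using p q that by linarith
    then show ?thesis unfolding eq by (rule x_point_window)
  qed
  moreover have "p + l \<le> length (superword (tau n) i a)"
    unfolding length_superword_tau using p q by linarith
  ultimately show "\<exists>m. \<exists>b\<in>{0..n}. \<exists>p. p + l \<le> length (superword (tau n) m b) \<and>
      (\<forall>j<l. x_point n a (k + int j) = superword (tau n) m b ! (p + j))"
    using assms by blast
qed

lemma letter_in_superword_0: "b \<le> n \<Longrightarrow> b \<in> set (superword (tau n) b 0)"
proof (induction b)
  case (Suc b)
  then have "b \<in> set (superword (tau n) b 0)" by simp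
  moreover have "Suc b \<in> set (tau n b)" using Suc.prems by (simp add: tau_def succ_letter_def)
  ultimately show ?case by (auto simp: set_subst_word)
qed simp

lemma superword_appears_in_x_point_0:
  assumes "b \<le> n"
  shows "word_appears (superword (tau n) m b) (x_point n 0)"
proof -
  obtain u v where "superword (tau n) b 0 = u @ [b] @ v"
    using split_list[OF letter_in_superword_0[OF assms]] by auto
  then have split: "superword (tau n) (m + b) 0 =
      (subst_word (tau n) ^^ m) u @ superword (tau n) m b @ (subst_word (tau n) ^^ m) v"
    by (simp only: funpow_add o_apply subst_word_funpow_append)
  let ?u = "(subst_word (tau n) ^^ m) u" and ?c = "int (length (left_word n (m + b)))"
  have "x_point n 0 (int (length ?u) - ?c + int j) = superword (tau n) m b ! j"
    if j: "j < length (superword (tau n) m b)" for j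
  proof -
    have "length ?u + j < length (superword (tau n) (m + b) 0)"
      unfolding split using j by simp
    then have "x_point n 0 (int (length ?u + j) - ?c)
        = superword (tau n) (m + b) 0 ! (length ?u + j)"
      by (intro x_point_window) (simp only: length_superword_tau)
    also have "\<dots> = superword (tau n) m b ! j"
      unfolding split using j by (simp add: nth_append)
    also have "int (length ?u + j) - ?c = int (length ?u) - ?c + int j" by simp
    finally show ?thesis .
  qed
  then show ?thesis unfolding word_appears_def by blast
qed

lemma X_tau_eq_language_shift: "X_tau n = language_shift {0..n} (tau n)"
  unfolding X_tau_def
proof (rule substitution_subshift_eq_language_shift)
  show "set (tau n a) \<subseteq> {0..n}" if "a \<in> {0..n}" for a
    using set_tau that .
  show "\<exists>x\<in>language_shift {0..n} (tau n). word_appears (superword (tau n) m a) x"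
    if "a \<in> {0..n}" for m a
    using superword_appears_in_x_point_0[of a n m] x_point_in_language_shift[of 0 n] that by auto
qed

lemma subshift_X_tau: "subshift {0..n} (X_tau n)"
  unfolding X_tau_eq_language_shift by (rule subshift_language_shift) (rule set_tau)

lemma limitin_X_tau_shifts:
  assumes "x \<in> X_tau n" "z \<in> X_tau n"
    and "\<And>k i. \<bar>k\<bar> \<le> int i \<Longrightarrow> x (k + int (r i)) = z k"
  shows "limitin (subtopology (full_shift_topology {0..n}) (X_tau n))
           (\<lambda>i. (shift_map ^^ r i) x) z sequentially"
proof -
  have in_X: "(shift_map ^^ r i) x \<in> X_tau n" for i
    unfolding funpow_shift_map by (rule subshift_translate[OF subshift_X_tau assms(1)])
  have X: "X_tau n \<subseteq> {x. range x \<subseteq> {0..n}}"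
    using subshift_X_tau[of n] closedin_subset unfolding subshift_def by fastforce
  have "limitin (full_shift_topology {0..n}) (\<lambda>i. (shift_map ^^ r i) x) z sequentially"
  proof (rule limitin_full_shiftI)
    show "range z \<subseteq> {0..n}" using X assms(2) by blast
    show "\<forall>\<^sub>F i in sequentially. range ((shift_map ^^ r i) x) \<subseteq> {0..n}"
      using X in_X by (intro always_eventually) blast
    show "\<forall>\<^sub>F i in sequentially. (shift_map ^^ r i) x k = z k" for k
      using eventually_ge_at_top[of "nat \<bar>k\<bar>"]
      by eventually_elim (simp add: funpow_shift_map assms(3))
  qed
  then show ?thesis using in_X assms(2) by (simp add: limitin_subtopology)
qed

theorem mainTheorem12:
  fixes n :: nat and \<rho> :: "(int \<Rightarrow> nat) \<Rightarrow> (int \<Rightarrow> nat) \<Rightarrow> real"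
  assumes "n > 0"
    and "Metric_space (X_tau n) \<rho>"
    and "Metric_space.mtopology (X_tau n) \<rho> =
           subtopology (full_shift_topology {0..n}) (X_tau n)"
  shows "x_point n ` {0..n} \<subseteq> X_tau n \<and>
         scrambled shift_map \<rho> (x_point n ` {0..n}) \<and>
         card (x_point n ` {0..n}) = card {0..n}"
proof (intro conjI)
  interpret Metric_space "X_tau n" \<rho> by (fact assms(2))
  have in_X: "x_point n a \<in> X_tau n" if "a \<in> {0..n}" for a
    using x_point_in_language_shift[OF that] by (simp add: X_tau_eq_language_shift)
  then show "x_point n ` {0..n} \<subseteq> X_tau n" by blast
  have "inj_on (x_point n) {0..n}" by (metis x_point_zero inj_onI)
  then show "card (x_point n ` {0..n}) = card {0..n}" by (rule card_image)
  have return: "limitin mtopology (\<lambda>i. (shift_map ^^ (5 ^ i)) (x_point n a))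
      (x_point n a) sequentially" if "a \<in> {0..n}" for a
    unfolding assms(3) using in_X[OF that] in_X[OF that]
    by (rule limitin_X_tau_shifts) (simp add: x_point_recurs)
  have visit: "limitin mtopology (\<lambda>i. (shift_map ^^ (3 * 5 ^ i)) (x_point n a))
      (x_point n 0) sequentially" if "a \<in> {0..n}" for a
    unfolding assms(3)
    by (rule limitin_X_tau_shifts)
      (use that in \<open>simp_all add: in_X x_point_visits_x_point_0\<close>)
  have times: "strict_mono (\<lambda>i. 5 ^ i :: nat)" "strict_mono (\<lambda>i. 3 * 5 ^ i :: nat)"
    by (auto simp: strict_mono_Suc_iff)
  show "scrambled shift_map \<rho> (x_point n ` {0..n})"
    unfolding scrambled_def ball_simps
  proof (intro ballI impI)
    fix a b assume "a \<in> {0..n}" "b \<in> {0..n}" "x_point n a \<noteq> x_point n b"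
    then show "li_yorke_pair shift_map \<rho> (x_point n a) (x_point n b)"
      by (intro li_yorke_pair_if_subsequences[where z = "x_point n 0", OF _ times] return visit)
  qed
qed

end
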